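(* The $k$-bounded-lottery rounding scheme is $(1-1/e)$-approximate when valuations are submodular. That is, for all $n,m$, all $0\le k\le m$, all normalized monotone submodular functions $v_1,\dots,v_n:2^{[m]}\to\mathbb{R}_{\ge 0}$, and every $S\subseteq[m]$ with $|S|\le k$, $$\mathbf{E}_{T\sim r_k(1_S)}\left[\sum_{i=1}^n v_i(T)\right]\ \ge\ \left(1-\frac1e\right)\sum_{i=1}^n v_i(S),$$ where $1_S\in\{0,1\}^m$ is the indicator vector of $S$.
   Context: $[m]=\{1,\dots,m\}$. A set function $v$ is normalized if $v(\emptyset)=0$, monotone if $v(A)\le v(B)$ whenever $A\subseteq B$, and submodular if $v(A)+v(B)\ge v(A\cap B)+v(A\cup B)$ for all $A,B$. $k$-bounded-lottery rounding scheme $r_k$: for $x\in[0,1]^m$ with $\sum_j x_j\le k$, $r_k(x)$ is the distribution of the random set $\{j_1,\dots,j_k\}\setminus\{*\}\subseteq[m]$, where $j_1,\dots,j_k$ are independent draws from the distribution on $[m]\cup\{*\}$ giving $j\in[m]$ probability $x_j/k$ and $*$ the remaining probability $1-\frac1k\sum_j x_j$. (For $k=0$ there are no draws and $r_0(0)=\emptyset$ with probability 1.) A rounding scheme $r$ is $\alpha$-approximate for a class of valuations if for every integer point $x=1_S$ with $|S|\le k$ and all $v_i$ in the class, $\mathbf{E}_{T\sim r(x)}[\sum_i v_i(T)]\ge\alpha\sum_i v_i(S)$. *)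

theory Defs
  imports "HOL-Probability.Probability"
begin

text \<open>
  The ground set is \<open>{1..m}\<close>. A set function on its power set is a function of type
  \<open>nat set \<Rightarrow> real\<close> of which only the values at subsets of \<open>{1..m}\<close> matter; a point of
  \<open>[0,1]\<close> to the power \<open>m\<close> is a function \<open>nat \<Rightarrow> real\<close> of which only the values on
  \<open>{1..m}\<close> matter.
\<close>

definition normalized :: "(nat set \<Rightarrow> real) \<Rightarrow> bool" where
  "normalized v \<longleftrightarrow> v {} = 0"

definition monotone_valuation :: "nat \<Rightarrow> (nat set \<Rightarrow> real) \<Rightarrow> bool" where
  "monotone_valuation m v \<longleftrightarrow>
     (\<forall>A B. A \<subseteq> B \<and> B \<subseteq> {1..m} \<longrightarrow> v A \<le> v B)"

definition submodular :: "nat \<Rightarrow> (nat set \<Rightarrow> real) \<Rightarrow> bool" where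
  "submodular m v \<longleftrightarrow>
     (\<forall>A B. A \<subseteq> {1..m} \<and> B \<subseteq> {1..m} \<longrightarrow> v A + v B \<ge> v (A \<inter> B) + v (A \<union> B))"

definition submodular_valuations :: "nat \<Rightarrow> (nat set \<Rightarrow> real) set" where
  "submodular_valuations m =
     {v. (\<forall>A. A \<subseteq> {1..m} \<longrightarrow> v A \<ge> 0) \<and>
         normalized v \<and> monotone_valuation m v \<and> submodular m v}"

text \<open>
  A single draw; the extra outcome \<open>*\<close> is \<open>None\<close>. That the masses form a probability
  distribution is \<open>pmf_lottery_draw\<close> below. For \<open>k = 0\<close>, division by zero puts all the
  mass on \<open>None\<close>; this value is irrelevant, as no draw is then made.
\<close>

definition lottery_draw :: "nat \<Rightarrow> nat \<Rightarrow> (nat \<Rightarrow> real) \<Rightarrow> nat option pmf" where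
  "lottery_draw m k x = embed_pmf
     (\<lambda>d. case d of
        None \<Rightarrow> 1 - (1 / real k) * (\<Sum>j\<in>{1..m}. x j)
      | Some j \<Rightarrow> (if j \<in> {1..m} then x j / real k else 0))"

text \<open>
  \<open>Pi_pmf\<close> is the joint distribution of independent draws with indices in \<open>{1..k}\<close>; its
  second argument is only the default value outside that index set.
\<close>

definition bounded_lottery :: "nat \<Rightarrow> nat \<Rightarrow> (nat \<Rightarrow> real) \<Rightarrow> nat set pmf" where
  "bounded_lottery m k x =
     map_pmf (\<lambda>d. {j. Some j \<in> d ` {1..k}})
       (Pi_pmf {1..k} None (\<lambda>_. lottery_draw m k x))"

definition approximate_rounding ::
    "nat \<Rightarrow> nat \<Rightarrow> real \<Rightarrow> (nat set \<Rightarrow> real) set \<Rightarrow> ((nat \<Rightarrow> real) \<Rightarrow> nat set pmf) \<Rightarrow> bool" where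
  "approximate_rounding m k \<alpha> V r \<longleftrightarrow>
     (\<forall>S (n::nat) v. S \<subseteq> {1..m} \<and> card S \<le> k \<and> (\<forall>i\<in>{1..n}. v i \<in> V) \<longrightarrow>
        measure_pmf.expectation (r (indicator S)) (\<lambda>T. \<Sum>i\<in>{1..n}. v i T)
          \<ge> \<alpha> * (\<Sum>i\<in>{1..n}. v i S))"

lemma pmf_lottery_draw:
  assumes x: "\<And>j. j \<in> {1..m} \<Longrightarrow> x j \<ge> 0" and le: "(\<Sum>j\<in>{1..m}. x j) \<le> real k"
  shows "pmf (lottery_draw m k x) None = 1 - (1 / real k) * (\<Sum>j\<in>{1..m}. x j)"
    and "pmf (lottery_draw m k x) (Some j) = (if j \<in> {1..m} then x j / real k else 0)"
proof -
  define f where "f = (\<lambda>d. case d of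
        None \<Rightarrow> 1 - (1 / real k) * (\<Sum>j\<in>{1..m}. x j)
      | Some j \<Rightarrow> (if j \<in> {1..m} then x j / real k else 0))"
  have nonneg: "f d \<ge> 0" for d
    using x le by (cases "k = 0") (auto simp: f_def divide_simps split: option.splits)
  have supp: "f d = 0" if "d \<notin> insert None (Some ` {1..m})" for d
    using that by (auto simp: f_def split: option.splits)
  have "(\<integral>\<^sup>+d. ennreal (f d) \<partial>count_space UNIV)
      = (\<Sum>d\<in>insert None (Some ` {1..m}). ennreal (f d))"
    by (rule nn_integral_count_space'[OF _ _]) (use supp nonneg in auto)
  also have "\<dots> = ennreal (\<Sum>d\<in>insert None (Some ` {1..m}). f d)"
    by (rule sum_ennreal) (rule nonneg)
  also have "(\<Sum>d\<in>insert None (Some ` {1..m}). f d) = f None + (\<Sum>j\<in>{1..m}. f (Some j))"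
    by (subst sum.insert) (auto simp: sum.reindex)
  also have "\<dots> = 1"
    by (simp add: f_def sum_divide_distrib)
  finally have total: "(\<integral>\<^sup>+d. ennreal (f d) \<partial>count_space UNIV) = 1"
    by simp
  have eq: "pmf (lottery_draw m k x) d = f d" for d
    unfolding lottery_draw_def f_def[symmetric]
    by (rule pmf_embed_pmf[OF nonneg total])
  show "pmf (lottery_draw m k x) None = 1 - (1 / real k) * (\<Sum>j\<in>{1..m}. x j)"
    and "pmf (lottery_draw m k x) (Some j) = (if j \<in> {1..m} then x j / real k else 0)"
    by (simp_all add: eq f_def)
qed

lemma bounded_lottery_0: "bounded_lottery m 0 x = return_pmf {}"
  by (simp add: bounded_lottery_def)

end

theory Submission
  imports Defs
begin

text \<open>
  If \<open>T\<close> is the set obtained after some of the \<open>k\<close> draws, one more draw adds each element of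
  \<open>S\<close> with probability \<open>1/k\<close>, so by submodularity its expected marginal value is at least
  \<open>(v(S \<union> T) - v(T))/k \<ge> (v(S) - v(T))/k\<close>. Hence each draw shrinks the expected deficit
  \<open>v(S) - E[v(T)]\<close> by a factor \<open>1 - 1/k\<close>, and after \<open>k\<close> draws the deficit is at most
  \<open>(1 - 1/k)^k v(S) \<le> v(S)/e\<close>.
\<close>

text \<open>Every defining condition is a linear inequality or equation in the valuation. This lets
  the theorem for n valuations be proved for the single valuation that is their sum.\<close>

lemma submodular_valuations_sum:
  assumes "\<And>i. i \<in> I \<Longrightarrow> v i \<in> submodular_valuations m"
  shows "(\<lambda>A. \<Sum>i\<in>I. v i A) \<in> submodular_valuations m"
  using assms
  unfolding submodular_valuations_def normalized_def monotone_valuation_def submodular_def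
  by (auto simp flip: sum.distrib intro!: sum_nonneg sum_mono)

text \<open>Diminishing returns: adding the elements of \<open>S\<close> to \<open>T\<close> one at
  a time, each gains at most what it would gain if added to \<open>T\<close> alone.\<close>

lemma submodular_union_le_sum_marginals:
  assumes sub: "submodular m v" and mono: "monotone_valuation m v"
    and T: "T \<subseteq> {1..m}" and S: "S \<subseteq> {1..m}"
  shows "v (S \<union> T) - v T \<le> (\<Sum>j\<in>S. v (insert j T) - v T)"
proof -
  have "finite S"
    using S by (rule finite_subset) simp
  then show ?thesis
    using S
  proof (induction S rule: finite_induct)
    case (insert j S)
    have ground: "S \<union> T \<subseteq> {1..m}" "insert j T \<subseteq> {1..m}"
      using insert.prems T by auto
    \<comment> \<open>The element \<open>j\<close> gains no more on top of
      \<open>S \<union> T\<close> than on top of \<open>T\<close>: the intersection of the two sets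
      contains \<open>T\<close>, and their union is the next set of the induction.\<close>
    then have "v ((S \<union> T) \<inter> insert j T) + v ((S \<union> T) \<union> insert j T) \<le> v (S \<union> T) + v (insert j T)"
      using sub unfolding submodular_def by blast
    moreover have "v T \<le> v ((S \<union> T) \<inter> insert j T)"
      using mono ground unfolding monotone_valuation_def by (metis Int_greatest Un_upper2 le_infI2 subset_insertI)
    moreover have "(S \<union> T) \<union> insert j T = insert j S \<union> T"
      by auto
    ultimately show ?case
      using insert by auto
  qed simp
qed

lemma pmf_lottery_draw_indicator:
  assumes S: "S \<subseteq> {1..m}" and le: "card S \<le> k"
  shows "pmf (lottery_draw m k (indicator S)) None = 1 - real (card S) / real k"
    and "pmf (lottery_draw m k (indicator S)) (Some j) = indicator S j / real k"
    and "set_pmf (lottery_draw m k (indicator S)) \<subseteq> insert None (Some ` S)"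
proof -
  have sum: "(\<Sum>j\<in>{1..m}. indicator S j :: real) = real (card S)"
    using S by (simp add: sum.inter_restrict[symmetric] indicator_def Int_absorb1 flip: of_bool_def)
  show "pmf (lottery_draw m k (indicator S)) None = 1 - real (card S) / real k"
    by (subst pmf_lottery_draw) (use le sum in auto)
  show Some: "pmf (lottery_draw m k (indicator S)) (Some j) = indicator S j / real k" for j
    by (subst pmf_lottery_draw) (use S le sum in \<open>auto simp: indicator_def\<close>)
  show "set_pmf (lottery_draw m k (indicator S)) \<subseteq> insert None (Some ` S)"
  proof
    fix d assume d: "d \<in> set_pmf (lottery_draw m k (indicator S))"
    show "d \<in> insert None (Some ` S)"
      using d by (cases d) (auto simp: set_pmf_iff Some indicator_def split: if_splits)
  qed
qed

text \<open>The bound is affine in \<open>v T\<close>, so that averaging it over a random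
  \<open>T\<close> gives a recursion for the expected value.\<close>

lemma expectation_lottery_draw_ge:
  assumes v: "v \<in> submodular_valuations m" and S: "S \<subseteq> {1..m}" and le: "card S \<le> k"
    and T: "T \<subseteq> {1..m}" and k: "k > 0"
  shows "measure_pmf.expectation (lottery_draw m k (indicator S)) (\<lambda>d. v (set_option d \<union> T))
           \<ge> (1 - 1 / k) * v T + v S / k"
proof -
  have fin: "finite S"
    using S by (rule finite_subset) simp
  have sub: "submodular m v" and mono: "monotone_valuation m v"
    using v by (auto simp: submodular_valuations_def)
  have "v S \<le> v (S \<union> T)"
    using mono S T unfolding monotone_valuation_def by (meson Un_least Un_upper1)
  with submodular_union_le_sum_marginals[OF sub mono T S]
  have gain: "v S - v T \<le> (\<Sum>j\<in>S. v (insert j T) - v T)"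
    by linarith
  have "measure_pmf.expectation (lottery_draw m k (indicator S)) (\<lambda>d. v (set_option d \<union> T))
      = (\<Sum>d\<in>insert None (Some ` S).
           v (set_option d \<union> T) * pmf (lottery_draw m k (indicator S)) d)"
    by (rule integral_measure_pmf_real)
      (use fin pmf_lottery_draw_indicator(3)[OF S le] in auto)
  also have "\<dots> = v T * (1 - card S / k) + (\<Sum>j\<in>S. v (insert j T) / k)"
    using fin by (simp add: sum.reindex pmf_lottery_draw_indicator[OF S le])
  \<comment> \<open>The \<open>card S / k\<close> copies of \<open>v T\<close> missing from the
    first term are moved into the sum, turning values into marginals.\<close>
  also have "\<dots> = v T + (\<Sum>j\<in>S. v (insert j T) - v T) / k"
    using k by (simp add: sum_subtractf field_simps flip: sum_divide_distrib)
  also have "\<dots> \<ge> v T + (v S - v T) / k"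
    using gain k by (simp add: divide_right_mono)
  also have "v T + (v S - v T) / k = (1 - 1 / k) * v T + v S / k"
    by (simp add: algebra_simps diff_divide_distrib)
  finally show ?thesis .
qed

text \<open>The number \<open>l\<close> of draws is separate from the \<open>k\<close> that fixes
  the probabilities inside \<open>D\<close>, which makes induction on the draws possible. The
  lottery itself is the case \<open>l = k\<close>.\<close>

definition drawn_set :: "nat \<Rightarrow> nat option pmf \<Rightarrow> nat set pmf" where
  "drawn_set l D = map_pmf (\<lambda>d. {j. Some j \<in> d ` {1..l}}) (Pi_pmf {1..l} None (\<lambda>_. D))"

lemma drawn_set_0: "drawn_set 0 D = return_pmf {}"
  by (simp add: drawn_set_def)

text \<open>By independence the product splits into the last draw and the first \<open>l\<close>
  draws. The outcome \<open>None\<close> adds nothing, since its \<open>set_option\<close> is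
  empty.\<close>

lemma drawn_set_Suc:
  "drawn_set (Suc l) D = bind_pmf (drawn_set l D) (\<lambda>T. map_pmf (\<lambda>d. set_option d \<union> T) D)"
proof -
  have ins: "{1..Suc l} = insert (Suc l) {1..l}"
    by auto
  have upd: "{j. Some j = y \<or> Some j \<in> A} = set_option y \<union> {j. Some j \<in> A}"
    for y and A :: "nat option set"
    by (cases y) auto
  have "drawn_set (Suc l) D = map_pmf (\<lambda>(y, f). set_option y \<union> {j. Some j \<in> f ` {1..l}})
      (pair_pmf D (Pi_pmf {1..l} None (\<lambda>_. D)))"
    unfolding drawn_set_def ins
    by (subst Pi_pmf_insert) (simp_all add: pmf.map_comp o_def case_prod_unfold upd)
  also have "\<dots> = bind_pmf (drawn_set l D) (\<lambda>T. map_pmf (\<lambda>d. set_option d \<union> T) D)"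
    unfolding drawn_set_def
    by (subst pair_commute_pmf)
      (simp add: pair_pmf_def map_pmf_def bind_assoc_pmf bind_return_pmf)
  finally show ?thesis .
qed

text \<open>For finite \<open>S\<close> this makes the support finite, so all expectations are
  finite sums; it also keeps \<open>T\<close> inside the ground set, where the valuation is
  controlled.\<close>

lemma set_drawn_set_subset:
  assumes "set_pmf D \<subseteq> insert None (Some ` S)"
  shows "set_pmf (drawn_set l D) \<subseteq> Pow S"
  by (induction l) (use assms in \<open>fastforce simp: drawn_set_0 drawn_set_Suc\<close>)+

lemma expectation_drawn_set_ge:
  assumes v: "v \<in> submodular_valuations m" and S: "S \<subseteq> {1..m}" and le: "card S \<le> k"
    and k: "k > 0"
  shows "measure_pmf.expectation (drawn_set l (lottery_draw m k (indicator S))) v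
           \<ge> (1 - (1 - 1 / k) ^ l) * v S"
proof (induction l)
  case 0
  show ?case
    using v by (simp add: drawn_set_0 submodular_valuations_def normalized_def)
next
  case (Suc l)
  define D where "D = lottery_draw m k (indicator S)"
  define E where "E l = measure_pmf.expectation (drawn_set l D) v" for l
  have fin: "finite S"
    using S by (rule finite_subset) simp
  have D: "set_pmf D \<subseteq> insert None (Some ` S)"
    unfolding D_def by (rule pmf_lottery_draw_indicator(3)[OF S le])
  have finD: "finite (set_pmf D)"
    using finite_subset[OF D] fin by simp
  have supp: "set_pmf (drawn_set l D) \<subseteq> Pow S"
    by (rule set_drawn_set_subset[OF D])
  have finL: "finite (set_pmf (drawn_set l D))"
    using finite_subset[OF supp] fin by simp
  have integrable: "integrable (measure_pmf (drawn_set l D)) f" for f :: "nat set \<Rightarrow> real"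
    by (rule integrable_measure_pmf_finite[OF finL])
  have "E (Suc l) = (\<Sum>T\<in>set_pmf (drawn_set l D). pmf (drawn_set l D) T *
      measure_pmf.expectation D (\<lambda>d. v (set_option d \<union> T)))"
    unfolding E_def drawn_set_Suc
    by (subst pmf_expectation_bind[OF finL]) (use finD in auto)
  also have "\<dots> = measure_pmf.expectation (drawn_set l D)
      (\<lambda>T. measure_pmf.expectation D (\<lambda>d. v (set_option d \<union> T)))"
    by (subst integral_measure_pmf_real[OF finL]) (auto simp: mult.commute)
  also have "\<dots> \<ge> measure_pmf.expectation (drawn_set l D) (\<lambda>T. (1 - 1 / k) * v T + v S / k)"
  proof (rule integral_mono_AE[OF integrable integrable], rule AE_pmfI)
    fix T assume "T \<in> set_pmf (drawn_set l D)"
    then have "T \<subseteq> {1..m}"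
      using supp S by blast
    then show "(1 - 1 / k) * v T + v S / k
        \<le> measure_pmf.expectation D (\<lambda>d. v (set_option d \<union> T))"
      unfolding D_def by (rule expectation_lottery_draw_ge[OF v S le _ k])
  qed
  also have "measure_pmf.expectation (drawn_set l D) (\<lambda>T. (1 - 1 / k) * v T + v S / k)
      = (1 - 1 / k) * E l + v S / k"
    unfolding E_def by (subst Bochner_Integration.integral_add[OF integrable integrable]) simp
  finally have "(1 - 1 / k) * E l + v S / k \<le> E (Suc l)" .
  moreover have "(1 - 1 / k) * ((1 - (1 - 1 / k) ^ l) * v S) \<le> (1 - 1 / k) * E l"
    using Suc.IH k unfolding E_def D_def by (intro mult_left_mono) auto
  moreover have "(1 - (1 - 1 / k) ^ Suc l) * v S
      = (1 - 1 / k) * ((1 - (1 - 1 / k) ^ l) * v S) + v S / k"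
    by (simp add: algebra_simps)
  ultimately show ?case
    unfolding E_def D_def by linarith
qed

theorem lemma3p3:
  fixes m k :: nat
  assumes "k \<le> m"
  shows "approximate_rounding m k (1 - 1 / exp 1) (submodular_valuations m) (bounded_lottery m k)"
  unfolding approximate_rounding_def
proof (intro allI impI, elim conjE)
  fix S n and v :: "nat \<Rightarrow> nat set \<Rightarrow> real"
  assume S: "S \<subseteq> {1..m}" and le: "card S \<le> k"
    and "\<forall>i\<in>{1..n}. v i \<in> submodular_valuations m"
  define w where "w = (\<lambda>A. \<Sum>i\<in>{1..n}. v i A)"
  have w: "w \<in> submodular_valuations m"
    unfolding w_def by (rule submodular_valuations_sum) (use \<open>\<forall>i\<in>{1..n}. _\<close> in auto)
  have "(1 - 1 / exp 1) * w S \<le> measure_pmf.expectation (bounded_lottery m k (indicator S)) w"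
  proof (cases "k = 0")
    case True
    moreover have "S = {}"
      using True le S finite_subset[OF S] by auto
    ultimately show ?thesis
      using w by (simp add: bounded_lottery_0 submodular_valuations_def normalized_def)
  next
    case False
    \<comment> \<open>This is the bound (1 - x/n)^n \<le> exp (-x) at x = 1 and n =
      \<open>k\<close>.\<close>
    then have "(1 - 1 / k) ^ k \<le> exp (- 1 :: real)"
      by (intro exp_ge_one_minus_x_over_n_power_n) auto
    then have "1 - 1 / exp 1 \<le> 1 - (1 - 1 / k) ^ k"
      by (simp add: exp_minus inverse_eq_divide)
    moreover have "w S \<ge> 0"
      using w S by (simp add: submodular_valuations_def)
    ultimately have "(1 - 1 / exp 1) * w S \<le> (1 - (1 - 1 / k) ^ k) * w S"
      by (rule mult_right_mono)
    also have "\<dots> \<le> measure_pmf.expectation (drawn_set k (lottery_draw m k (indicator S))) w"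
      using expectation_drawn_set_ge[OF w S le] False by simp
    finally show ?thesis
      by (simp add: bounded_lottery_def drawn_set_def)
  qed
  then show "(1 - 1 / exp 1) * (\<Sum>i\<in>{1..n}. v i S)
      \<le> measure_pmf.expectation (bounded_lottery m k (indicator S)) (\<lambda>T. \<Sum>i\<in>{1..n}. v i T)"
    by (simp add: w_def)
qed

end
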